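(* Any bounded geometry metric space with subexponential decomposition growth has property A.
   Context: $\mathbb{R}^+$ denotes the positive reals. A metric space $X$ has bounded geometry if it is locally finite and for every $r\in\mathbb{R}^+$ there is $N(r)$ such that $|B(x,r)|\le N(r)$ for every $x\in X$. For nonempty subsets $A,B$ of a metric space, $d(A,B)=\inf\{d(a,b):a\in A,b\in B\}$. For $R>0$, a family $\mathcal{U}$ of nonempty subsets of a metric space is $R$-disjoint if $d(A,B)>R$ for all $A,B\in\mathcal{U}$ with $A\neq B$. A metric family is a family of metric spaces (subsets of a metric space carry the restricted metric); it is uniformly bounded if the supremum of the diameters of its members is finite. A metric space $X$ $(R,n)$-decomposes over a metric family $\mathcal{V}$, written $X\stackrel{R,n}{\longrightarrow}\mathcal{V}$, if there is a family $\mathcal{U}=\mathcal{U}_1\cup\dots\cup\mathcal{U}_n$ of subsets of $X$ covering $X$ such that each $\mathcal{U}_i$ is $R$-disjoint and $\mathcal{U}\subset\mathcal{V}$. For metric families, $\mathcal{U}\stackrel{R,n}{\longrightarrow}\mathcal{V}$ means that every member of $\mathcal{U}$ $(R,n)$-decomposes over $\mathcal{V}$. A non-decreasing function $s:\mathbb{R}^+\to\mathbb{N}$ is a decomposition complexity growth function for a metric space $X$ if for every sequence $R_1\le R_2\le\cdots$ of positive reals there exist a positive integer $n$ and metric families $\mathcal{V}_1,\dots,\mathcal{V}_n$ with $$X\stackrel{R_1,s(R_1)}{\longrightarrow}\mathcal{V}_1\stackrel{R_2,s(R_2)}{\longrightarrow}\mathcal{V}_2\stackrel{R_3,s(R_3)}{\longrightarrow}\cdots\stackrel{R_n,s(R_n)}{\longrightarrow}\mathcal{V}_n$$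 and $\mathcal{V}_n$ uniformly bounded. Non-decreasing $s,t:\mathbb{R}^+\to\mathbb{N}$ have the same growth if there are constants $a,c>0$ such that $s(ax)\ge t(x)-c$ and $t(ax)\ge s(x)-c$ for all $x>0$. A non-decreasing $s:\mathbb{R}^+\to\mathbb{N}$ is subexponential if $\lim_{x\to\infty}s(x)^{1/x}=1$. A metric space has subexponential decomposition growth if it has a decomposition complexity growth function that has the same growth as some subexponential function. A bounded geometry metric space $X$ has property A if there is a sequence of functions $f^n:X\to\ell_1(X)$, $x\mapsto f^n_x$, such that: (1) $f^n_x\ge 0$ and $\|f^n_x\|=1$ for all $n$ and $x$; (2) for every $n$ there is $S_n>0$ such that $\operatorname{supp} f^n_x\subset B(x,S_n)$ for all $x\in X$; (3) for every $R>0$, $\lim_{n\to\infty}\sup\{\|f^n_x-f^n_y\|:d(x,y)\le R\}=0$. (This is the characterization of Yu's property A that the paper takes in place of the original definition; norms are $\ell_1$ norms.) *)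

theory Defs
  imports "HOL-Analysis.Analysis"
begin

text \<open>Metric spaces are values of the library type \<^typ>\<open>'a metric\<close> (a carrier with a distance),
  a subset \<open>A\<close> of \<open>X\<close> with the restricted metric is \<open>submetric X A\<close>, and a metric family
  is a set of metric spaces.  The balls \<open>B(x,r)\<close> are the open balls \<open>mball_of X x r\<close>; since they
  are only used with all radii quantified, closed balls would give the same notions.
  A function on the positive reals is a function on \<^typ>\<open>real\<close> of which only the values on
  \<open>{0<..}\<close> are ever constrained or used.\<close>

definition locally_finite_metric :: "'a metric \<Rightarrow> bool" where
  "locally_finite_metric X \<longleftrightarrow> (\<forall>x\<in>mspace X. \<forall>r>0. finite (mball_of X x r))"

definition bounded_geometry :: "'a metric \<Rightarrow> bool" where
  "bounded_geometry X \<longleftrightarrow> locally_finite_metric X \<and>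
     (\<forall>r>0. \<exists>N::nat. \<forall>x\<in>mspace X. card (mball_of X x r) \<le> N)"

text \<open>For nonempty subsets; the set of distances is then nonempty and bounded below by 0.\<close>

definition set_mdist :: "'a metric \<Rightarrow> 'a set \<Rightarrow> 'a set \<Rightarrow> real" where
  "set_mdist X A B = Inf {mdist X a b |a b. a \<in> A \<and> b \<in> B}"

definition R_disjoint :: "'a metric \<Rightarrow> real \<Rightarrow> 'a set set \<Rightarrow> bool" where
  "R_disjoint X R \<U> \<longleftrightarrow> (\<forall>A\<in>\<U>. A \<noteq> {} \<and> A \<subseteq> mspace X) \<and>
     (\<forall>A\<in>\<U>. \<forall>B\<in>\<U>. A \<noteq> B \<longrightarrow> set_mdist X A B > R)"

text \<open>Values in \<^typ>\<open>ennreal\<close>, so that infinite diameters are allowed and the supremum over the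
  empty set is 0.\<close>

definition mdiameter :: "'a metric \<Rightarrow> ennreal" where
  "mdiameter X = (SUP x\<in>mspace X. SUP y\<in>mspace X. ennreal (mdist X x y))"

definition uniformly_bounded :: "'a metric set \<Rightarrow> bool" where
  "uniformly_bounded \<V> \<longleftrightarrow> (SUP Y\<in>\<V>. mdiameter Y) < \<infinity>"

definition decomposes_over :: "'a metric \<Rightarrow> real \<Rightarrow> nat \<Rightarrow> 'a metric set \<Rightarrow> bool" where
  "decomposes_over X R n \<V> \<longleftrightarrow>
     (\<exists>\<U> :: nat \<Rightarrow> 'a set set.
        (\<forall>i\<in>{1..n}. R_disjoint X R (\<U> i)) \<and>
        \<Union> (\<Union>i\<in>{1..n}. \<U> i) = mspace X \<and>
        submetric X ` (\<Union>i\<in>{1..n}. \<U> i) \<subseteq> \<V>)"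

definition family_decomposes_over ::
    "'a metric set \<Rightarrow> real \<Rightarrow> nat \<Rightarrow> 'a metric set \<Rightarrow> bool" where
  "family_decomposes_over \<U> R n \<V> \<longleftrightarrow> (\<forall>Y\<in>\<U>. decomposes_over Y R n \<V>)"

text \<open>The sequence of radii and the chain of families are indexed from 1 as \<open>R 1, R 2, \<dots>\<close> and
  \<open>\<V> 1, \<dots>, \<V> n\<close>; the value \<open>R 0\<close> is not used.\<close>

definition decomposition_complexity_growth_function :: "'a metric \<Rightarrow> (real \<Rightarrow> nat) \<Rightarrow> bool" where
  "decomposition_complexity_growth_function X s \<longleftrightarrow> mono_on {0<..} s \<and>
     (\<forall>R :: nat \<Rightarrow> real. (\<forall>i\<ge>1. 0 < R i) \<and> mono_on {1..} R \<longrightarrow>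
        (\<exists>n\<ge>1. \<exists>\<V> :: nat \<Rightarrow> 'a metric set.
           decomposes_over X (R 1) (s (R 1)) (\<V> 1) \<and>
           (\<forall>i\<in>{1..<n}. family_decomposes_over (\<V> i) (R (Suc i)) (s (R (Suc i))) (\<V> (Suc i))) \<and>
           uniformly_bounded (\<V> n)))"

definition same_growth :: "(real \<Rightarrow> nat) \<Rightarrow> (real \<Rightarrow> nat) \<Rightarrow> bool" where
  "same_growth s t \<longleftrightarrow> (\<exists>a c :: real. a > 0 \<and> c > 0 \<and>
     (\<forall>x>0. real (s (a * x)) \<ge> real (t x) - c \<and> real (t (a * x)) \<ge> real (s x) - c))"

definition subexponential :: "(real \<Rightarrow> nat) \<Rightarrow> bool" where
  "subexponential s \<longleftrightarrow> mono_on {0<..} s \<and>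
     ((\<lambda>x. real (s x) powr (1 / x)) \<longlongrightarrow> 1) at_top"

definition subexponential_decomposition_growth :: "'a metric \<Rightarrow> bool" where
  "subexponential_decomposition_growth X \<longleftrightarrow>
     (\<exists>s t. decomposition_complexity_growth_function X s \<and> subexponential t \<and> same_growth s t)"

text \<open>Real-valued absolutely summable functions on \<open>S\<close>; values outside \<open>S\<close> are ignored.\<close>

definition ell1 :: "'a set \<Rightarrow> ('a \<Rightarrow> real) set" where
  "ell1 S = {f. (\<lambda>z. \<bar>f z\<bar>) summable_on S}"

definition ell1_norm :: "'a set \<Rightarrow> ('a \<Rightarrow> real) \<Rightarrow> real" where
  "ell1_norm S f = (\<Sum>\<^sub>\<infinity>z\<in>S. \<bar>f z\<bar>)"

text \<open>The supremum is taken in \<^typ>\<open>ennreal\<close>, so that it is 0 when \<open>X\<close> is empty.\<close>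

definition property_A :: "'a metric \<Rightarrow> bool" where
  "property_A X \<longleftrightarrow>
     (\<exists>f :: nat \<Rightarrow> 'a \<Rightarrow> 'a \<Rightarrow> real.
        (\<forall>n. \<forall>x\<in>mspace X. f n x \<in> ell1 (mspace X)) \<and>
        (\<forall>n. \<forall>x\<in>mspace X. (\<forall>z\<in>mspace X. f n x z \<ge> 0) \<and> ell1_norm (mspace X) (f n x) = 1) \<and>
        (\<forall>n. \<exists>S>0. \<forall>x\<in>mspace X. {z \<in> mspace X. f n x z \<noteq> 0} \<subseteq> mball_of X x S) \<and>
        (\<forall>R>0. (\<lambda>n. SUP (x, y) \<in> {(x, y). x \<in> mspace X \<and> y \<in> mspace X \<and> mdist X x y \<le> R}.
                   ennreal (ell1_norm (mspace X) (\<lambda>z. f n x z - f n y z))) \<longlonglongrightarrow> 0))"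

end

theory Submission
  imports Defs
begin

text \<open>Suppose \<open>Y\<close> decomposes into \<open>m\<close> families \<open>\<U>\<^sub>1, \<dots>, \<U>\<^sub>m\<close>, each \<open>R\<close>-disjoint, and the pieces carry maps
  into probability measures that vary by at most \<open>e\<close> at scale \<open>L + R\<close>.  Averaging these maps over
  the \<open>m\<close> families with the weights \<open>exp (- lam * d(x, \<Union>\<U>\<^sub>i))\<close> gives a map on \<open>Y\<close>: the normalized
  weights vary by at most \<open>exp (2 * lam * L) - 1\<close> at scale \<open>L\<close>, independently of \<open>m\<close>, and the
  families far from \<open>x\<close> contribute at most \<open>2 * m * exp (- lam * (R / 4 - L))\<close>.  As \<open>m = s(R)\<close> is
  subexponential in \<open>R\<close>, choosing first \<open>lam\<close> small and then \<open>R\<close> large makes the added error as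
  small as desired.  Hence the radii can be chosen recursively, before the length of the
  decomposition is known, such that the \<open>i\<close>-th step adds an error of at most \<open>\<epsilon> / 2\<^sup>i\<close>.\<close>

section \<open>Finitely supported probability functions\<close>

definition fin_prob :: "'a set \<Rightarrow> ('a \<Rightarrow> real) \<Rightarrow> bool" where
  "fin_prob B f \<longleftrightarrow> (\<forall>z. 0 \<le> f z) \<and>
     (\<exists>F. finite F \<and> F \<subseteq> B \<and> (\<forall>z. z \<notin> F \<longrightarrow> f z = 0) \<and> sum f F = 1)"

text \<open>Bounding all finite partial sums by \<open>e\<close> says that the l1 distance is at
  most \<open>e\<close>, and spares questions of summability. Scale, error and support radius are
  explicit parameters, since one triple must serve all members of a family.\<close>

definition A_approximable :: "'a metric \<Rightarrow> real \<Rightarrow> real \<Rightarrow> real \<Rightarrow> bool" where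
  "A_approximable Y L e D \<longleftrightarrow> (\<exists>f. (\<forall>x\<in>mspace Y. fin_prob (mball_of Y x D) (f x)) \<and>
     (\<forall>x\<in>mspace Y. \<forall>y\<in>mspace Y. mdist Y x y \<le> L \<longrightarrow>
        (\<forall>F. finite F \<longrightarrow> (\<Sum>z\<in>F. \<bar>f x z - f y z\<bar>) \<le> e)))"

lemma fin_prob_nonneg: "fin_prob B f \<Longrightarrow> 0 \<le> f z"
  by (simp add: fin_prob_def)

lemma fin_prob_mono: "fin_prob B f \<Longrightarrow> B \<subseteq> C \<Longrightarrow> fin_prob C f"
  unfolding fin_prob_def by blast

lemma fin_prob_indicator: "x \<in> B \<Longrightarrow> fin_prob B (indicator {x})"
  unfolding fin_prob_def by (intro conjI exI[of _ "{x}"]) auto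

lemma fin_prob_sum_eq_1:
  assumes "finite G" "finite F" "F \<subseteq> G" "\<forall>z. z \<notin> F \<longrightarrow> f z = 0" "sum f F = (1::real)"
  shows "sum f G = 1"
  using sum.mono_neutral_right[of G F f] assms by auto

lemma fin_prob_sum_le_1:
  assumes "fin_prob B f" "finite G"
  shows "sum f G \<le> 1"
proof -
  obtain F where F: "finite F" "\<forall>z. z \<notin> F \<longrightarrow> f z = 0" "sum f F = 1"
    using assms(1) unfolding fin_prob_def by blast
  have "sum f G \<le> sum f (F \<union> G)"
    using assms F by (intro sum_mono2) (auto simp: fin_prob_def)
  also have "\<dots> = 1"
    by (rule fin_prob_sum_eq_1[of _ F]) (use F assms in auto)
  finally show ?thesis .
qed

lemma fin_prob_convex_sum:
  assumes "finite I" "\<And>i. i \<in> I \<Longrightarrow> 0 \<le> c i" "sum c I = 1"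
    and mu: "\<And>i. i \<in> I \<Longrightarrow> fin_prob B (mu i)"
  shows "fin_prob B (\<lambda>z. \<Sum>i\<in>I. c i * mu i z)"
proof -
  have "\<forall>i\<in>I. \<exists>F. finite F \<and> F \<subseteq> B \<and> (\<forall>z. z \<notin> F \<longrightarrow> mu i z = 0) \<and> sum (mu i) F = 1"
    using mu unfolding fin_prob_def by blast
  then obtain F where F: "\<forall>i\<in>I. finite (F i) \<and> F i \<subseteq> B \<and> (\<forall>z. z \<notin> F i \<longrightarrow> mu i z = 0)
      \<and> sum (mu i) (F i) = 1"
    by (rule bchoice[THEN exE])
  let ?G = "\<Union>i\<in>I. F i"
  have 1: "sum (mu i) ?G = 1" if "i \<in> I" for i
    by (rule fin_prob_sum_eq_1[of _ "F i"]) (use F that assms(1) in auto)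
  have "(\<Sum>z\<in>?G. \<Sum>i\<in>I. c i * mu i z) = (\<Sum>i\<in>I. c i * sum (mu i) ?G)"
    by (subst sum.swap) (simp add: sum_distrib_left)
  also have "\<dots> = 1"
    using 1 assms(3) by simp
  finally have "(\<Sum>z\<in>?G. \<Sum>i\<in>I. c i * mu i z) = 1" .
  moreover have "(\<Sum>i\<in>I. c i * mu i z) = 0" if "z \<notin> ?G" for z
    using that F by (intro sum.neutral) auto
  moreover have "0 \<le> (\<Sum>i\<in>I. c i * mu i z)" for z
    using assms(2) fin_prob_nonneg[OF mu] by (intro sum_nonneg) auto
  ultimately show ?thesis
    unfolding fin_prob_def using F assms(1) by (intro conjI allI exI[of _ ?G]) auto
qed

section \<open>Variation of averaged maps\<close>

text \<open>Split \<open>a i * \<mu> i z - b i * \<nu> i z\<close> into a change of measure and a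
  change of weight. Summed over \<open>i\<close>, the second gives only \<open>\<delta>\<close>,
  since the weight error is relative to \<open>a i\<close>. The slack \<open>k\<close> covers
  indices where the measures may differ a lot but the weight is small.\<close>

lemma sum_abs_convex_sum_diff_le:
  fixes a b :: "'i \<Rightarrow> real" and \<mu> \<nu> :: "'i \<Rightarrow> 'a \<Rightarrow> real"
  assumes "finite I" "sum a I = 1"
    and a: "\<And>i. i \<in> I \<Longrightarrow> 0 \<le> a i"
    and ab: "\<And>i. i \<in> I \<Longrightarrow> \<bar>a i - b i\<bar> \<le> \<delta> * a i"
    and \<nu>: "\<And>i z. i \<in> I \<Longrightarrow> 0 \<le> \<nu> i z" "\<And>i. i \<in> I \<Longrightarrow> sum (\<nu> i) F \<le> 1"
    and \<mu>\<nu>: "\<And>i. i \<in> I \<Longrightarrow> a i * (\<Sum>z\<in>F. \<bar>\<mu> i z - \<nu> i z\<bar>) \<le> a i * e + k"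
  shows "(\<Sum>z\<in>F. \<bar>(\<Sum>i\<in>I. a i * \<mu> i z) - (\<Sum>i\<in>I. b i * \<nu> i z)\<bar>) \<le> e + \<delta> + real (card I) * k"
proof -
  have "(\<Sum>z\<in>F. \<bar>(\<Sum>i\<in>I. a i * \<mu> i z) - (\<Sum>i\<in>I. b i * \<nu> i z)\<bar>)
      \<le> (\<Sum>z\<in>F. \<Sum>i\<in>I. a i * \<bar>\<mu> i z - \<nu> i z\<bar> + \<bar>a i - b i\<bar> * \<nu> i z)"
  proof (rule sum_mono)
    fix z
    have "\<bar>(\<Sum>i\<in>I. a i * \<mu> i z) - (\<Sum>i\<in>I. b i * \<nu> i z)\<bar>
        \<le> (\<Sum>i\<in>I. \<bar>a i * \<mu> i z - b i * \<nu> i z\<bar>)"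
      by (simp flip: sum_subtractf)
    also have "\<dots> \<le> (\<Sum>i\<in>I. a i * \<bar>\<mu> i z - \<nu> i z\<bar> + \<bar>a i - b i\<bar> * \<nu> i z)"
    proof (rule sum_mono)
      fix i assume i: "i \<in> I"
      have "a i * \<mu> i z - b i * \<nu> i z = a i * (\<mu> i z - \<nu> i z) + (a i - b i) * \<nu> i z"
        by (simp add: algebra_simps)
      then show "\<bar>a i * \<mu> i z - b i * \<nu> i z\<bar> \<le> a i * \<bar>\<mu> i z - \<nu> i z\<bar> + \<bar>a i - b i\<bar> * \<nu> i z"
        using abs_triangle_ineq[of "a i * (\<mu> i z - \<nu> i z)" "(a i - b i) * \<nu> i z"] a[OF i] \<nu>(1)[OF i]
        by (simp add: abs_mult)
    qed
    finally show "\<bar>(\<Sum>i\<in>I. a i * \<mu> i z) - (\<Sum>i\<in>I. b i * \<nu> i z)\<bar>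
        \<le> (\<Sum>i\<in>I. a i * \<bar>\<mu> i z - \<nu> i z\<bar> + \<bar>a i - b i\<bar> * \<nu> i z)" .
  qed
  also have "\<dots> = (\<Sum>i\<in>I. a i * (\<Sum>z\<in>F. \<bar>\<mu> i z - \<nu> i z\<bar>) + \<bar>a i - b i\<bar> * sum (\<nu> i) F)"
    by (subst sum.swap) (simp add: sum.distrib sum_distrib_left)
  also have "\<dots> \<le> (\<Sum>i\<in>I. (a i * e + k) + \<delta> * a i)"
  proof (rule sum_mono)
    fix i assume i: "i \<in> I"
    have "\<bar>a i - b i\<bar> * sum (\<nu> i) F \<le> \<bar>a i - b i\<bar>"
      using \<nu>(2)[OF i] by (simp add: mult_left_le)
    then show "a i * (\<Sum>z\<in>F. \<bar>\<mu> i z - \<nu> i z\<bar>) + \<bar>a i - b i\<bar> * sum (\<nu> i) F \<le> (a i * e + k) + \<delta> * a i"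
      using \<mu>\<nu>[OF i] ab[OF i] by linarith
  qed
  also have "\<dots> = e + \<delta> + real (card I) * k"
    using assms(2) by (simp add: sum.distrib flip: sum_distrib_left sum_distrib_right)
  finally show ?thesis .
qed

lemma INF_mdist_Lipschitz:
  assumes "S \<noteq> {}" "S \<subseteq> mspace Y" "x \<in> mspace Y" "y \<in> mspace Y"
  shows "(INF q\<in>S. mdist Y x q) \<le> (INF q\<in>S. mdist Y y q) + mdist Y x y"
proof -
  have "(INF q\<in>S. mdist Y x q) - mdist Y x y \<le> (INF q\<in>S. mdist Y y q)"
  proof (rule cINF_greatest[OF assms(1)])
    fix q assume q: "q \<in> S"
    have "(INF q\<in>S. mdist Y x q) \<le> mdist Y x q"
      by (intro cINF_lower q bdd_belowI[of _ 0]) auto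
    also have "\<dots> \<le> mdist Y x y + mdist Y y q"
      using q assms by (intro mdist_triangle) auto
    finally show "(INF q\<in>S. mdist Y x q) - mdist Y x y \<le> mdist Y y q" by simp
  qed
  then show ?thesis by simp
qed

lemma set_mdist_le: "a \<in> A \<Longrightarrow> b \<in> B \<Longrightarrow> set_mdist X A B \<le> mdist X a b"
  unfolding set_mdist_def by (intro cInf_lower bdd_belowI[of _ 0]) auto

text \<open>The two quotients agree up to the factor \<open>t\<^sup>2\<close>. The error is kept
  relative to \<open>v / W\<close>, so that its sum over all normalized weights does not grow with
  their number.\<close>

lemma normalized_weight_diff_le:
  fixes v v' W W' t :: real
  assumes "0 < v" "0 < v'" "0 < W" "0 < W'" "0 < t"
    and "v \<le> t * v'" "v' \<le> t * v" "W \<le> t * W'" "W' \<le> t * W"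
  shows "\<bar>v / W - v' / W'\<bar> \<le> (t\<^sup>2 - 1) * (v / W)"
proof -
  define a b where "a = v / W" and "b = v' / W'"
  have "v' * W \<le> (t * v) * (t * W')"
    using assms by (intro mult_mono) auto
  then have 1: "b \<le> t\<^sup>2 * a"
    using assms by (simp add: a_def b_def field_simps power2_eq_square)
  have "v * W' \<le> (t * v') * (t * W)"
    using assms by (intro mult_mono) auto
  then have 2: "a \<le> t\<^sup>2 * b"
    using assms by (simp add: a_def b_def field_simps power2_eq_square)
  have "0 < a" using assms by (simp add: a_def)
  \<comment> \<open>Up to the factor \<open>a\<close>, this is
    \<open>1 - 1 / t\<^sup>2 \<le> t\<^sup>2 - 1\<close> with the denominator cleared; it lets both
    directions of the comparison yield the same factor.\<close>
  have "(t\<^sup>2 - 1)\<^sup>2 * a \<ge> 0" using \<open>0 < a\<close> by simp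
  have "t\<^sup>2 * (a - b) \<le> t\<^sup>2 * a - a" using 2 by (simp add: algebra_simps)
  also have "\<dots> \<le> t\<^sup>2 * ((t\<^sup>2 - 1) * a)"
    using \<open>(t\<^sup>2 - 1)\<^sup>2 * a \<ge> 0\<close> by (simp add: algebra_simps power2_eq_square)
  finally have "a - b \<le> (t\<^sup>2 - 1) * a"
    using \<open>0 < t\<close> by simp
  with 1 show ?thesis
    unfolding a_def[symmetric] b_def[symmetric] by (simp add: abs_le_iff algebra_simps)
qed

section \<open>The gluing step\<close>

text \<open>The three error terms come from the maps on the pieces, from the normalized weights, and
  from the families far from the point. The pieces are taken at scale \<open>L + R\<close> to leave
  room for moving points into them first; this move also enlarges the support radius.\<close>

lemma A_approximable_decomposes_over:
  assumes dec: "decomposes_over Y R m V"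
    and app: "\<And>Z. Z \<in> V \<Longrightarrow> A_approximable Z (L + R) e D"
    and "0 < L" "2 * L \<le> R" "0 \<le> lam" "0 < D" "0 \<le> e"
  shows "A_approximable Y L (e + (exp (2 * lam * L) - 1) + real m * (2 * exp (- lam * (R / 4 - L)))) (D + R)"
proof -
  obtain U :: "nat \<Rightarrow> 'a set set" where
    U: "(\<forall>i\<in>{1..m}. R_disjoint Y R (U i)) \<and> \<Union> (\<Union>i\<in>{1..m}. U i) = mspace Y \<and>
      submetric Y ` (\<Union>i\<in>{1..m}. U i) \<subseteq> V"
    using dec unfolding decomposes_over_def by (rule exE)
  have disj: "R_disjoint Y R (U i)" if "i \<in> {1..m}" for i
    using U that by blast
  have cover: "\<Union> (\<Union>i\<in>{1..m}. U i) = mspace Y"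
    using U by blast
  have mem: "submetric Y A \<in> V" if "i \<in> {1..m}" "A \<in> U i" for i A
    using U that by blast
  \<comment> \<open>An empty family has no distance to a point, hence only nonempty families get a
    weight.\<close>
  define I where "I = {i\<in>{1..m}. U i \<noteq> {}}"
  have I: "finite I" "card I \<le> m" "\<And>i. i \<in> I \<Longrightarrow> i \<in> {1..m}"
    using card_mono[of "{1..m}" I] by (simp_all add: I_def subset_iff)
  have sub: "A \<subseteq> mspace Y" "A \<noteq> {}" if "i \<in> I" "A \<in> U i" for i A
    using disj[OF I(3)[OF that(1)]] that(2) unfolding R_disjoint_def by blast+
  define S where "S i = \<Union> (U i)" for i
  have S: "S i \<noteq> {}" "S i \<subseteq> mspace Y" if i: "i \<in> I" for i
  proof -
    obtain A where "A \<in> U i" using i unfolding I_def by blast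
    then show "S i \<noteq> {}" using sub(2)[OF i] unfolding S_def by blast
    show "S i \<subseteq> mspace Y" using sub(1)[OF i] unfolding S_def by blast
  qed
  define d where "d i x = (INF q\<in>S i. mdist Y x q)" for i x
  have d0: "0 \<le> d i x" if "i \<in> I" for i x
    unfolding d_def using S(1)[OF that] by (rule cINF_greatest) simp
  have dle: "d i x \<le> mdist Y x q" if "q \<in> S i" for i x q
    unfolding d_def by (intro cINF_lower that bdd_belowI[of _ 0]) auto
  define w where "w i x = exp (- lam * d i x)" for i x
  define W where "W x = (\<Sum>i\<in>I. w i x)" for x
  \<comment> \<open>By the covering, some family contains \<open>x\<close> and has weight 1 there.
    Hence normalizing never increases a weight, and small weights stay small.\<close>
  have W1: "1 \<le> W x" if x: "x \<in> mspace Y" for x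
  proof -
    obtain i where i: "i \<in> I" "x \<in> S i"
      using x unfolding cover[symmetric] I_def S_def by blast
    have "mdist Y x x = 0" using x by simp
    then have "d i x = 0"
      using dle[OF i(2), of x] d0[OF i(1), of x] by linarith
    then have "1 = w i x" by (simp add: w_def)
    also have "\<dots> \<le> W x"
      unfolding W_def using i I by (intro member_le_sum) (auto simp: w_def)
    finally show ?thesis .
  qed
  have "\<exists>g. (\<forall>x\<in>A. fin_prob (mball_of (submetric Y A) x D) (g x)) \<and>
     (\<forall>x\<in>A. \<forall>y\<in>A. mdist Y x y \<le> L + R \<longrightarrow>
        (\<forall>F. finite F \<longrightarrow> (\<Sum>z\<in>F. \<bar>g x z - g y z\<bar>) \<le> e))" if "i \<in> I" "A \<in> U i" for A i
    using app[OF mem[OF I(3)[OF that(1)] that(2)]] sub(1)[OF that]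
    by (simp add: A_approximable_def Int_absorb2 add.commute del: in_mball_of)
  then have "\<forall>A\<in>(\<Union>i\<in>I. U i). \<exists>g. (\<forall>x\<in>A. fin_prob (mball_of (submetric Y A) x D) (g x)) \<and>
     (\<forall>x\<in>A. \<forall>y\<in>A. mdist Y x y \<le> L + R \<longrightarrow>
        (\<forall>F. finite F \<longrightarrow> (\<Sum>z\<in>F. \<bar>g x z - g y z\<bar>) \<le> e))"
    by blast
  \<comment> \<open>The map \<open>g A\<close> depends on the set alone, so points moved into the
    same member are compared under one map.\<close>
  then obtain g where g: "\<And>i A x. i \<in> I \<Longrightarrow> A \<in> U i \<Longrightarrow> x \<in> A \<Longrightarrow> fin_prob (mball_of (submetric Y A) x D) (g A x)"
    "\<And>i A x y F. i \<in> I \<Longrightarrow> A \<in> U i \<Longrightarrow> x \<in> A \<Longrightarrow> y \<in> A \<Longrightarrow> mdist Y x y \<le> L + R \<Longrightarrow> finite F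
      \<Longrightarrow> (\<Sum>z\<in>F. \<bar>g A x z - g A y z\<bar>) \<le> e"
    by (rule bchoice[THEN exE]) blast
  \<comment> \<open>Points within \<open>R / 4\<close> of a family are moved into it.  Since \<open>2 * L \<le> R\<close>, two such points at
    distance at most \<open>L\<close> end up in the same member, by \<open>R\<close>-disjointness.\<close>
  define near where "near i x \<longleftrightarrow> (\<exists>q\<in>S i. mdist Y x q < R / 4)" for i x
  have "\<forall>i x. \<exists>q A. near i x \<longrightarrow> A \<in> U i \<and> q \<in> A \<and> mdist Y x q < R / 4"
    unfolding near_def S_def by blast
  then obtain q A where qA: "\<And>i x. near i x \<Longrightarrow> A i x \<in> U i \<and> q i x \<in> A i x \<and> mdist Y x (q i x) < R / 4"
    by (simp only: choice_iff) blast
  \<comment> \<open>At points that are not near, the point mass is a default value: any probability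
    function supported close to \<open>x\<close> would serve, as the weight is small there.\<close>
  define mu where "mu i x = (if near i x then g (A i x) (q i x) else indicator {x})" for i x
  define f where "f x z = (\<Sum>i\<in>I. w i x / W x * mu i x z)" for x z
  have mu: "fin_prob (mball_of Y x (D + R)) (mu i x)" if i: "i \<in> I" and x: "x \<in> mspace Y" for i x
  proof (cases "near i x")
    case True
    note qA = qA[OF True]
    have qY: "q i x \<in> mspace Y" using qA sub[OF i] by blast
    have "mball_of (submetric Y (A i x)) (q i x) D \<subseteq> mball_of Y x (D + R)"
    proof
      fix z assume "z \<in> mball_of (submetric Y (A i x)) (q i x) D"
      then have z: "z \<in> mspace Y" "mdist Y (q i x) z < D"
        by auto
      have "mdist Y x z \<le> mdist Y x (q i x) + mdist Y (q i x) z"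
        using x qY z by (intro mdist_triangle)
      then show "z \<in> mball_of Y x (D + R)"
        using z x qA assms(3,4) by simp
    qed
    then show ?thesis
      using g(1)[OF i, of "A i x" "q i x"] qA True fin_prob_mono by (auto simp: mu_def)
  next
    case False
    have "mdist Y x x = 0" using x by simp
    then have "mdist Y x x < D + R" using assms(3,4,6) by linarith
    with False show ?thesis
      using x by (auto simp: mu_def intro!: fin_prob_indicator)
  qed
  have "fin_prob (mball_of Y x (D + R)) (f x)" if x: "x \<in> mspace Y" for x
    unfolding f_def
  proof (rule fin_prob_convex_sum)
    show "(\<Sum>i\<in>I. w i x / W x) = 1"
      using W1[OF x] by (simp add: W_def flip: sum_divide_distrib)
  qed (use I W1[OF x] mu x in \<open>auto simp: w_def\<close>)
  moreover have "(\<Sum>z\<in>F. \<bar>f x z - f y z\<bar>)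
      \<le> e + (exp (2 * lam * L) - 1) + real m * (2 * exp (- lam * (R / 4 - L)))"
    if x: "x \<in> mspace Y" and y: "y \<in> mspace Y" and xy: "mdist Y x y \<le> L" and F: "finite F" for x y F
  proof -
    let ?k = "2 * exp (- lam * (R / 4 - L))"
    \<comment> \<open>Each \<open>d i\<close> is 1-Lipschitz, so \<open>t\<close> bounds the ratio
      of weights, and of their sums, at scale \<open>L\<close>.\<close>
    define t where "t = exp (lam * L)"
    have t: "0 < t" "t\<^sup>2 = exp (2 * lam * L)"
      by (simp_all add: t_def power2_eq_square flip: exp_add)
    have w_le: "w i u \<le> t * w i v"
      if "i \<in> I" "u \<in> mspace Y" "v \<in> mspace Y" "mdist Y u v \<le> L" for i u v
    proof -
      have "d i v \<le> d i u + L"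
        using INF_mdist_Lipschitz[OF S[OF that(1)] that(3,2)] that(4) mdist_commute[of Y u v]
        by (simp add: d_def)
      then have "lam * d i v \<le> lam * (d i u + L)"
        using \<open>0 \<le> lam\<close> by (rule mult_left_mono)
      then show ?thesis
        by (simp add: w_def t_def algebra_simps flip: exp_add)
    qed
    have W_le: "W u \<le> t * W v"
      if "u \<in> mspace Y" "v \<in> mspace Y" "mdist Y u v \<le> L" for u v
      unfolding W_def sum_distrib_left using w_le that by (intro sum_mono) auto
    have yx: "mdist Y y x \<le> L" using xy by (simp add: mdist_commute)
    have "(\<Sum>z\<in>F. \<bar>f x z - f y z\<bar>) \<le> e + (t\<^sup>2 - 1) + real (card I) * ?k"
      unfolding f_def
    proof (rule sum_abs_convex_sum_diff_le)
      show "(\<Sum>i\<in>I. w i x / W x) = 1"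
        using W1[OF x] by (simp add: W_def flip: sum_divide_distrib)
    next
      fix i assume i: "i \<in> I"
      show "0 \<le> w i x / W x" using W1[OF x] by (simp add: w_def)
      show "\<bar>w i x / W x - w i y / W y\<bar> \<le> (t\<^sup>2 - 1) * (w i x / W x)"
        using W1[OF x] W1[OF y] t(1)
        by (intro normalized_weight_diff_le w_le W_le i x y xy yx) (auto simp: w_def)
      show "0 \<le> mu i y z" for z
        using mu[OF i y] by (rule fin_prob_nonneg)
      show "sum (mu i y) F \<le> 1"
        using mu[OF i y] F by (rule fin_prob_sum_le_1)
      show "w i x / W x * (\<Sum>z\<in>F. \<bar>mu i x z - mu i y z\<bar>) \<le> w i x / W x * e + ?k"
      proof (cases "near i x \<and> near i y")
        case True
        let ?p = "q i x" and ?r = "q i y"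
        note X = qA[of i x] and Y = qA[of i y]
        have Yp: "?p \<in> mspace Y" "?r \<in> mspace Y"
          using X Y True sub[OF i] by blast+
        have "mdist Y ?p ?r \<le> mdist Y ?p x + mdist Y x y + mdist Y y ?r"
          using mdist_triangle[of ?p Y x ?r] mdist_triangle[of x Y y ?r] x y Yp by simp
        then have dist: "mdist Y ?p ?r \<le> R / 2 + L"
          using X Y True xy mdist_commute[of Y ?p x] by simp
        have "A i x = A i y"
        proof (rule ccontr)
          assume "A i x \<noteq> A i y"
          then have "R < set_mdist Y (A i x) (A i y)"
            using disj[OF I(3)[OF i]] X Y True by (auto simp: R_disjoint_def)
          also have "\<dots> \<le> mdist Y ?p ?r"
            using X Y True by (intro set_mdist_le) auto
          finally show False using dist assms(4) by simp
        qed
        then have "(\<Sum>z\<in>F. \<bar>mu i x z - mu i y z\<bar>) \<le> e"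
          using g(2)[OF i, of "A i x" ?p ?r F] X Y True dist F assms(3,4) by (simp add: mu_def)
        then have "w i x / W x * (\<Sum>z\<in>F. \<bar>mu i x z - mu i y z\<bar>) \<le> w i x / W x * e"
          using W1[OF x] by (intro mult_left_mono) (auto simp: w_def)
        then show ?thesis by (smt (verit) exp_ge_zero)
      next
        case False
        have far: "R / 4 \<le> d i u" if "\<not> near i u" for u
          unfolding d_def using S[OF i] that by (intro cINF_greatest) (auto simp: near_def not_less)
        \<comment> \<open>If \<open>x\<close> is not near, \<open>d i x\<close> is at least
          \<open>R / 4\<close>; if only \<open>y\<close> is not near, the Lipschitz bound loses at
          most \<open>L\<close>.\<close>
        have "R / 4 - L \<le> d i x"
          using False far INF_mdist_Lipschitz[OF S[OF i] y x] yx assms(3) by (fastforce simp: d_def)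
        then have "lam * (R / 4 - L) \<le> lam * d i x"
          using \<open>0 \<le> lam\<close> by (rule mult_left_mono)
        then have "w i x \<le> exp (- lam * (R / 4 - L))" by (simp add: w_def)
        moreover have "w i x / W x \<le> w i x"
          using W1[OF x] by (simp add: w_def divide_le_eq)
        ultimately have wk: "w i x / W x \<le> exp (- lam * (R / 4 - L))" by linarith
        have "(\<Sum>z\<in>F. \<bar>mu i x z - mu i y z\<bar>) \<le> (\<Sum>z\<in>F. mu i x z + mu i y z)"
          using fin_prob_nonneg[OF mu[OF i x]] fin_prob_nonneg[OF mu[OF i y]]
          by (intro sum_mono) (smt (verit))
        also have "\<dots> \<le> 2"
          using fin_prob_sum_le_1[OF mu[OF i x] F] fin_prob_sum_le_1[OF mu[OF i y] F]
          by (simp add: sum.distrib)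
        finally have "w i x / W x * (\<Sum>z\<in>F. \<bar>mu i x z - mu i y z\<bar>) \<le> exp (- lam * (R / 4 - L)) * 2"
          using wk by (intro mult_mono) (auto intro: sum_nonneg)
        moreover have "0 \<le> w i x / W x * e"
          using W1[OF x] \<open>0 \<le> e\<close> by (simp add: w_def)
        ultimately show ?thesis by linarith
      qed
    qed (rule I(1))
    also have "\<dots> \<le> e + (t\<^sup>2 - 1) + real m * ?k"
      using I(2) by (intro add_left_mono mult_right_mono) auto
    finally show ?thesis by (simp only: t(2))
  qed
  ultimately show ?thesis
    unfolding A_approximable_def by blast
qed

section \<open>Uniformly bounded families\<close>

text \<open>A constant map does not vary at any scale: all points go to the point mass at a fixed
  \<open>p\<close>, which lies in the ball of radius \<open>D\<close> around every point.\<close>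

lemma A_approximable_bounded:
  assumes "\<And>x y. x \<in> mspace Y \<Longrightarrow> y \<in> mspace Y \<Longrightarrow> mdist Y x y < D" "0 \<le> e"
  shows "A_approximable Y L e D"
proof (cases "mspace Y = {}")
  case False
  then obtain p where "p \<in> mspace Y" by blast
  then show ?thesis
    unfolding A_approximable_def using assms
    by (intro exI[of _ "\<lambda>x. indicator {p}"]) (auto intro!: fin_prob_indicator)
qed (auto simp: A_approximable_def)

lemma uniformly_bounded_mdist_less:
  assumes "uniformly_bounded V"
  obtains D where "0 < D" "\<And>Y x y. Y \<in> V \<Longrightarrow> x \<in> mspace Y \<Longrightarrow> y \<in> mspace Y \<Longrightarrow> mdist Y x y < D"
proof -
  obtain c where c: "(SUP Y\<in>V. mdiameter Y) = ennreal c" "0 \<le> c"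
    using assms unfolding uniformly_bounded_def
    by (cases "SUP Y\<in>V. mdiameter Y" rule: ennreal_cases) auto
  have "mdist Y x y \<le> c" if "Y \<in> V" "x \<in> mspace Y" "y \<in> mspace Y" for Y x y
  proof -
    have "ennreal (mdist Y x y) \<le> mdiameter Y"
      unfolding mdiameter_def using that by (intro SUP_upper2[OF that(2)] SUP_upper)
    also have "\<dots> \<le> ennreal c"
      unfolding c(1)[symmetric] using that by (intro SUP_upper)
    finally show ?thesis using c(2) by (simp add: ennreal_le_iff)
  qed
  then show thesis
    \<comment> \<open>Adding 1 makes the distance bound strict, as open balls demand, and the radius
      positive.\<close>
    using c(2) by (intro that[of "c + 1"]) (auto simp: le_less_trans[of _ c] add_strict_increasing)
qed

section \<open>Subexponential growth and the choice of a radius\<close>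

text \<open>The same growth gives \<open>s x \<le> t (a * x) + c\<close>. The rescaling by
  \<open>a\<close> is harmless because \<open>t\<close> is eventually below
  \<open>exp (h * x)\<close> for every \<open>h > 0\<close>.\<close>

lemma subexponential_times_exp_tendsto_0:
  assumes "subexponential t" "same_growth s t" "0 < lam"
  shows "((\<lambda>R. real (s R) * exp (- lam * R)) \<longlongrightarrow> 0) at_top"
proof -
  obtain a c where a: "0 < a" and c: "0 < c" and st: "\<And>x. 0 < x \<Longrightarrow> real (t (a * x)) \<ge> real (s x) - c"
    using assms(2) unfolding same_growth_def by blast
  \<comment> \<open>This \<open>h\<close> turns the bound on \<open>t (a * x)\<close> into
    \<open>exp (lam / 2 * x)\<close>, which uses up half of the decay rate.\<close>
  define h where "h = lam / (2 * a)"
  have ha: "h * (a * x) = lam / 2 * x" for x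
    using a by (simp add: h_def)
  have h: "0 < h" using assms(3) a by (simp add: h_def)
  have "\<forall>\<^sub>F x in at_top. real (t x) powr (1 / x) < exp h"
    using assms(1) h unfolding subexponential_def by (intro order_tendstoD(2)[of _ 1]) auto
  then have "\<forall>\<^sub>F x in at_top. real (t x) \<le> exp (h * x)"
    using eventually_gt_at_top[of 0]
  proof eventually_elim
    case (elim x)
    have "real (t x) = (real (t x) powr (1 / x)) powr x"
      using elim(2) by (simp add: powr_powr)
    also have "\<dots> \<le> exp h powr x"
      using elim by (intro powr_mono2) auto
    finally show ?case by (simp add: powr_def mult.commute)
  qed
  moreover have "filterlim (\<lambda>x. a * x) at_top at_top"
    using a by (intro filterlim_tendsto_pos_mult_at_top[OF tendsto_const] filterlim_ident)
  ultimately have "\<forall>\<^sub>F x in at_top. real (t (a * x)) \<le> exp (h * (a * x))"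
    by (rule eventually_compose_filterlim)
  then have le: "\<forall>\<^sub>F x in at_top. real (s x) * exp (- lam * x) \<le> exp (- (lam / 2) * x) + c * exp (- lam * x)"
    using eventually_gt_at_top[of 0]
  proof eventually_elim
    case (elim x)
    have "real (s x) \<le> exp (lam / 2 * x) + c"
      using st[OF elim(2)] elim(1) unfolding ha by linarith
    then have "real (s x) * exp (- lam * x) \<le> (exp (lam / 2 * x) + c) * exp (- lam * x)"
      by (rule mult_right_mono) simp
    also have "\<dots> = exp (- (lam / 2) * x) + c * exp (- lam * x)"
      by (simp add: algebra_simps flip: exp_add)
    finally show ?case .
  qed
  have "((\<lambda>x. exp (- k * x)) \<longlongrightarrow> 0) at_top" if "0 < k" for k :: real
    using that
    by (intro filterlim_compose[OF exp_at_bot] filterlim_tendsto_neg_mult_at_bot[OF tendsto_const] filterlim_ident) auto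
  from this[of "lam / 2"] this[of lam]
  have "((\<lambda>x. exp (- (lam / 2) * x) + c * exp (- lam * x)) \<longlongrightarrow> 0 + c * 0) at_top"
    using assms(3) by (intro tendsto_add tendsto_mult_left) auto
  then have lim: "((\<lambda>x. exp (- (lam / 2) * x) + c * exp (- lam * x)) \<longlongrightarrow> 0) at_top"
    by simp
  show ?thesis
    by (rule tendsto_sandwich[OF _ le tendsto_const lim]) simp
qed

lemma ex_decomposition_radius:
  assumes "subexponential t" "same_growth s t" "0 < L" "0 < \<eta>"
  shows "\<exists>R lam. 2 * L \<le> R \<and> 0 \<le> lam \<and>
    (exp (2 * lam * L) - 1) + real (s R) * (2 * exp (- lam * (R / 4 - L))) \<le> \<eta>"
proof -
  \<comment> \<open>This solves \<open>exp (2 * lam * L) - 1 = \<eta> / 2\<close>; the other half of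
    \<open>\<eta>\<close> is left for the far families.\<close>
  define lam where "lam = ln (1 + \<eta> / 2) / (2 * L)"
  have lam: "0 < lam" "exp (2 * lam * L) = 1 + \<eta> / 2"
    using assms(3,4) by (simp_all add: lam_def)
  \<comment> \<open>The constants anticipate the splitting of
    \<open>exp (- lam * (R / 4 - L))\<close> into a factor independent of \<open>R\<close> and a
    decay of rate \<open>lam / 4\<close>.\<close>
  have "((\<lambda>R. 2 * exp (lam * L) * (real (s R) * exp (- (lam / 4) * R))) \<longlongrightarrow> 2 * exp (lam * L) * 0) at_top"
    using lam by (intro tendsto_mult_left subexponential_times_exp_tendsto_0[OF assms(1,2)]) auto
  then have "\<forall>\<^sub>F R in at_top. 2 * exp (lam * L) * (real (s R) * exp (- (lam / 4) * R)) < \<eta> / 2"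
    using assms(4) by (intro order_tendstoD(2)) auto
  then obtain R where R: "2 * exp (lam * L) * (real (s R) * exp (- (lam / 4) * R)) < \<eta> / 2" "2 * L \<le> R"
    using eventually_happens'[OF _ eventually_conj[OF _ eventually_ge_at_top[of "2 * L"]]] by force
  have "exp (- lam * (R / 4 - L)) = exp (lam * L) * exp (- (lam / 4) * R)"
    by (simp add: algebra_simps flip: exp_add)
  then have "real (s R) * (2 * exp (- lam * (R / 4 - L))) \<le> \<eta> / 2"
    using R(1) by (simp add: mult_ac)
  then show ?thesis
    using R(2) lam by (intro exI[of _ R] exI[of _ lam]) auto
qed

section \<open>Descent along the chain of families\<close>

text \<open>Members of the \<open>k\<close>-th family are handled at scale \<open>L k\<close> with
  error \<open>\<epsilon> / 2 ^ k\<close>, by descending induction from the bounded family at the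
  end of the chain. Consecutive scales differ by the radius of the step, as gluing requires.\<close>

lemma ex_A_approximable:
  assumes s: "decomposition_complexity_growth_function X s" and "subexponential t" "same_growth s t"
    and "0 < L\<^sub>0" "0 < \<epsilon>"
  shows "\<exists>D>0. A_approximable X L\<^sub>0 \<epsilon> D"
proof -
  define Q where "Q k l R \<longleftrightarrow> (\<exists>lam\<ge>0. (exp (2 * lam * l) - 1)
      + real (s R) * (2 * exp (- lam * (R / 4 - l))) \<le> \<epsilon> / 2 ^ Suc k)" for k :: nat and l R
  \<comment> \<open>The first conjunct is the invariant of the recursion, the second relates
    consecutive scales. The next scale is the current one plus a radius that keeps the added error
    below \<open>\<epsilon> / 2 ^ Suc k\<close>.\<close>
  have "\<exists>L. \<forall>k. (0 < L k \<and> (k = 0 \<longrightarrow> L k = L\<^sub>0)) \<and>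
      (2 * L k \<le> L (Suc k) - L k \<and> Q k (L k) (L (Suc k) - L k))"
  proof (rule dependent_nat_choice)
    fix l :: real and k :: nat assume l: "0 < l \<and> (k = 0 \<longrightarrow> l = L\<^sub>0)"
    obtain R lam where R: "2 * l \<le> R" "0 \<le> lam"
      "(exp (2 * lam * l) - 1) + real (s R) * (2 * exp (- lam * (R / 4 - l))) \<le> \<epsilon> / 2 ^ Suc k"
      using ex_decomposition_radius[OF assms(2,3), of l "\<epsilon> / 2 ^ Suc k"] l assms(5) by auto
    then have "Q k l R" unfolding Q_def by blast
    then show "\<exists>y. (0 < y \<and> (Suc k = 0 \<longrightarrow> y = L\<^sub>0)) \<and> 2 * l \<le> y - l \<and> Q k l (y - l)"
      using R(1) l by (intro exI[of _ "l + R"]) simp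
  qed (use assms(4) in auto)
  then obtain L :: "nat \<Rightarrow> real" where L: "\<And>k. 0 < L k" "L 0 = L\<^sub>0" "\<And>k. 2 * L k \<le> L (Suc k) - L k"
    "\<And>k. Q k (L k) (L (Suc k) - L k)"
    by blast
  define R where "R k = L k - L (k - 1)" for k
  have RS: "R (Suc k) = L (Suc k) - L k" for k by (simp add: R_def)
  have "\<forall>i\<ge>1. 0 < R i"
  proof (intro allI impI)
    fix i :: nat assume "1 \<le> i"
    then obtain k where "i = Suc k" by (cases i) auto
    then show "0 < R i" using L(1)[of k] L(3)[of k] by (simp add: RS)
  qed
  moreover have "mono_on {1..} R"
  proof -
    \<comment> \<open>The left side is less than \<open>L (Suc k)\<close>, the right side at least
      twice that.\<close>
    have "R (Suc k) \<le> R (Suc (Suc k))" for k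
      using L(1)[of k] L(1)[of "Suc k"] L(3)[of "Suc k"] by (simp add: RS)
    then have "mono (\<lambda>k. R (Suc k))" by (rule mono_iff_le_Suc[THEN iffD2, OF allI])
    then have "R (Suc (i - 1)) \<le> R (Suc (j - 1))" if "i \<le> j" for i j
      using that by (meson diff_le_mono monoD)
    then show ?thesis by (fastforce intro!: mono_onI)
  qed
  ultimately obtain n V where "1 \<le> n" and
    V: "decomposes_over X (R 1) (s (R 1)) (V 1)"
      "\<And>i. i \<in> {1..<n} \<Longrightarrow> family_decomposes_over (V i) (R (Suc i)) (s (R (Suc i))) (V (Suc i))"
      "uniformly_bounded (V n)"
    using s unfolding decomposition_complexity_growth_function_def by meson
  \<comment> \<open>Index 0 is free in the chain; putting \<open>{X}\<close> there makes the
    decomposition of \<open>X\<close> the step with \<open>k = 0\<close>.\<close>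
  define V' where "V' = V(0 := {X})"
  have V': "family_decomposes_over (V' k) (R (Suc k)) (s (R (Suc k))) (V' (Suc k))" if "k < n" for k
    using that V(1) V(2)[of k] by (cases k) (auto simp: V'_def family_decomposes_over_def)
  have "\<exists>D>0. \<forall>Y\<in>V' k. A_approximable Y (L k) (\<epsilon> / 2 ^ k) D" if "k \<le> n" for k
    using that
  proof (induction k rule: inc_induct)
    case base
    obtain D where "0 < D" "\<And>Y x y. Y \<in> V n \<Longrightarrow> x \<in> mspace Y \<Longrightarrow> y \<in> mspace Y \<Longrightarrow> mdist Y x y < D"
      using V(3) uniformly_bounded_mdist_less by blast
    then show ?case
      using \<open>1 \<le> n\<close> assms(5) by (intro exI[of _ D]) (auto simp: V'_def intro!: A_approximable_bounded)
  next
    case (step k)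
    then obtain D where D: "0 < D" "\<And>Y. Y \<in> V' (Suc k) \<Longrightarrow> A_approximable Y (L (Suc k)) (\<epsilon> / 2 ^ Suc k) D"
      by blast
    obtain lam where lam: "0 \<le> lam"
      "(exp (2 * lam * L k) - 1) + real (s (R (Suc k))) * (2 * exp (- lam * (R (Suc k) / 4 - L k))) \<le> \<epsilon> / 2 ^ Suc k"
      using L(4)[of k] unfolding RS Q_def by blast
    have "A_approximable Y (L k) (\<epsilon> / 2 ^ k) (D + R (Suc k))" if "Y \<in> V' k" for Y
    proof -
      have "A_approximable Y (L k) (\<epsilon> / 2 ^ Suc k + (exp (2 * lam * L k) - 1)
          + real (s (R (Suc k))) * (2 * exp (- lam * (R (Suc k) / 4 - L k)))) (D + R (Suc k))"
        using V'[OF step(2)] that D L(1,3)[of k] lam(1) assms(5)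
        by (intro A_approximable_decomposes_over) (auto simp: family_decomposes_over_def RS)
      moreover have "\<epsilon> / 2 ^ Suc k + (exp (2 * lam * L k) - 1)
          + real (s (R (Suc k))) * (2 * exp (- lam * (R (Suc k) / 4 - L k))) \<le> \<epsilon> / 2 ^ k"
      proof -
        \<comment> \<open>One half of the error is inherited from the pieces, the other is what the
          choice of the radius allows.\<close>
        have "\<epsilon> / 2 ^ Suc k + \<epsilon> / 2 ^ Suc k = \<epsilon> / 2 ^ k" by simp
        then show ?thesis using lam(2) by linarith
      qed
      ultimately show ?thesis
        unfolding A_approximable_def by (meson order_trans)
    qed
    moreover have "0 < D + R (Suc k)"
      using D(1) L(1,3)[of k] by (simp add: RS)
    ultimately show ?case by blast
  qed
  from this[of 0] show ?thesis by (auto simp: V'_def L(2))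
qed

section \<open>From approximability to property A\<close>

lemma infsum_eq_sum_support:
  fixes f :: "'a \<Rightarrow> real"
  assumes "finite F" "F \<subseteq> S" "\<And>z. z \<notin> F \<Longrightarrow> f z = 0"
  shows "f summable_on S" "infsum f S = sum f F"
proof -
  have "f summable_on S \<longleftrightarrow> f summable_on F"
    using assms by (intro summable_on_cong_neutral) auto
  then show "f summable_on S" using assms(1) by simp
  have "infsum f S = infsum f F"
    using assms by (intro infsum_cong_neutral) auto
  then show "infsum f S = sum f F" using assms(1) by simp
qed

lemma fin_prob_ell1:
  assumes "fin_prob (mball_of X x D) f"
  shows "f \<in> ell1 (mspace X)" "ell1_norm (mspace X) f = 1" "{z \<in> mspace X. f z \<noteq> 0} \<subseteq> mball_of X x D"
proof -
  obtain F where F: "finite F" "F \<subseteq> mball_of X x D" "\<And>z. z \<notin> F \<Longrightarrow> f z = 0" "sum f F = 1"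
    using assms unfolding fin_prob_def by blast
  have "F \<subseteq> mspace X" using F(2) by auto
  moreover have "\<bar>f z\<bar> = f z" for z using fin_prob_nonneg[OF assms] by simp
  ultimately show "f \<in> ell1 (mspace X)" "ell1_norm (mspace X) f = 1"
    unfolding ell1_def ell1_norm_def using infsum_eq_sum_support[of F "mspace X" f] F by auto
  show "{z \<in> mspace X. f z \<noteq> 0} \<subseteq> mball_of X x D" using F by blast
qed

text \<open>The sum over the whole space is one of the finite sums, namely that over the union of
  two finite supports.\<close>

lemma ell1_norm_diff_le:
  assumes f: "fin_prob (mball_of X x D) f" and g: "fin_prob (mball_of X y D) g"
    and le: "\<And>F. finite F \<Longrightarrow> (\<Sum>z\<in>F. \<bar>f z - g z\<bar>) \<le> e"
  shows "ell1_norm (mspace X) (\<lambda>z. f z - g z) \<le> e"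
proof -
  obtain F where F: "finite F" "F \<subseteq> mball_of X x D" "\<And>z. z \<notin> F \<Longrightarrow> f z = 0"
    using f unfolding fin_prob_def by blast
  obtain G where G: "finite G" "G \<subseteq> mball_of X y D" "\<And>z. z \<notin> G \<Longrightarrow> g z = 0"
    using g unfolding fin_prob_def by blast
  have "F \<union> G \<subseteq> mspace X" using F(2) G(2) by auto
  then have "ell1_norm (mspace X) (\<lambda>z. f z - g z) = (\<Sum>z\<in>F \<union> G. \<bar>f z - g z\<bar>)"
    unfolding ell1_norm_def using F G by (intro infsum_eq_sum_support) auto
  then show ?thesis using le F G by simp
qed

text \<open>The \<open>n\<close>-th map is taken at scale \<open>n + 1\<close> with error
  \<open>1 / (n + 1)\<close>.\<close>

lemma property_A_if_A_approximable:
  assumes "\<And>L e. 0 < L \<Longrightarrow> 0 < e \<Longrightarrow> \<exists>D>0. A_approximable X L e D"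
  shows "property_A X"
proof -
  define P where "P n D f \<longleftrightarrow> (\<forall>x\<in>mspace X. fin_prob (mball_of X x D) (f x)) \<and>
     (\<forall>x\<in>mspace X. \<forall>y\<in>mspace X. mdist X x y \<le> real (Suc n) \<longrightarrow>
        (\<forall>F. finite F \<longrightarrow> (\<Sum>z\<in>F. \<bar>f x z - f y z\<bar>) \<le> inverse (real (Suc n))))" for n D f
  have "\<exists>D f. 0 < D \<and> P n D f" for n
    using assms[of "real (Suc n)" "inverse (real (Suc n))"] unfolding A_approximable_def P_def by auto
  then obtain D f where D: "\<And>n. 0 < D n" and P: "\<And>n. P n (D n) (f n)"
    by metis
  have f: "fin_prob (mball_of X x (D n)) (f n x)" if "x \<in> mspace X" for n x
    using P[of n] that unfolding P_def by blast
  have lip: "(\<Sum>z\<in>F. \<bar>f n x z - f n y z\<bar>) \<le> inverse (real (Suc n))"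
    if "x \<in> mspace X" "y \<in> mspace X" "mdist X x y \<le> real (Suc n)" "finite F" for n x y F
    using P[of n] that unfolding P_def by blast
  have "(\<lambda>n. SUP (x, y) \<in> {(x, y). x \<in> mspace X \<and> y \<in> mspace X \<and> mdist X x y \<le> R}.
      ennreal (ell1_norm (mspace X) (\<lambda>z. f n x z - f n y z))) \<longlonglongrightarrow> 0" for R
  proof (rule tendsto_sandwich[of "\<lambda>_. 0", OF _ _ tendsto_const])
    show "(\<lambda>n. ennreal (inverse (real (Suc n)))) \<longlonglongrightarrow> 0"
      using tendsto_ennrealI[OF LIMSEQ_inverse_real_of_nat] by simp
    \<comment> \<open>From \<open>N\<close> on, every pair at distance at most \<open>R\<close>
      falls within the scale of the \<open>n\<close>-th map, so the supremum is bounded by its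
      error.\<close>
    obtain N where N: "R \<le> real N" using real_arch_simple by blast
    show "\<forall>\<^sub>F n in sequentially. (SUP (x, y) \<in> {(x, y). x \<in> mspace X \<and> y \<in> mspace X \<and> mdist X x y \<le> R}.
      ennreal (ell1_norm (mspace X) (\<lambda>z. f n x z - f n y z))) \<le> ennreal (inverse (real (Suc n)))"
      using eventually_ge_at_top[of N]
    proof eventually_elim
      case (elim n)
      have "ell1_norm (mspace X) (\<lambda>z. f n x z - f n y z) \<le> inverse (real (Suc n))"
        if "x \<in> mspace X" "y \<in> mspace X" "mdist X x y \<le> R" for x y
        using that N elim by (intro ell1_norm_diff_le[OF f f] lip) auto
      then show ?case by (auto intro!: SUP_least ennreal_leI)
    qed
  qed simp
  then show ?thesis
    unfolding property_A_def using fin_prob_ell1[OF f] fin_prob_nonneg[OF f] D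
    by (intro exI[of _ f]) blast
qed

theorem theorem3p3:
  fixes X :: "'a metric"
  assumes "bounded_geometry X"
    and "subexponential_decomposition_growth X"
  shows "property_A X"
  using assms(2) ex_A_approximable property_A_if_A_approximable
  unfolding subexponential_decomposition_growth_def by blast

end
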